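(* Let $r\geq 2$ be an integer and let $G$ be a bipartite graph with maximum degree $\Delta(G)=2r$ such that $d_G(v)\in\{1,2,2r-2,2r-1,2r\}$ for every vertex $v\in V(G)$. Then $G$ has a cyclic interval $2r$-coloring.
   Context: All graphs are finite and undirected; multiple edges are allowed, loops are not. A proper $t$-edge coloring of $G$ is a map $\alpha:E(G)\to\{1,\dots,t\}$ with $\alpha(e)\neq\alpha(e')$ for adjacent edges $e,e'$. For a vertex $v$, $S(v,\alpha)$ is the set of colors on edges incident to $v$. A proper $t$-edge coloring $\alpha$ is a cyclic interval $t$-coloring if for every vertex $v$, either $S(v,\alpha)$ is a set of consecutive integers, or $\{1,\dots,t\}\setminus S(v,\alpha)$ is a set of consecutive integers. *)

theory Defs
  imports Main
begin

(* Undirected multigraphs: edges are objects of their own, so parallel edges are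
   distinct edges with the same set of ends. *)
record ('v, 'e) pre_multigraph =
  verts :: "'v set"
  edges :: "'e set"
  ends :: "'e \<Rightarrow> 'v set"

(* card = 2 excludes loops *)
locale fin_multigraph =
  fixes G :: "('v, 'e) pre_multigraph"
  assumes finite_verts: "finite (verts G)"
    and finite_edges: "finite (edges G)"
    and ends_subset: "e \<in> edges G \<Longrightarrow> ends G e \<subseteq> verts G"
    and card_ends: "e \<in> edges G \<Longrightarrow> card (ends G e) = 2"

definition incident_edges :: "('v, 'e) pre_multigraph \<Rightarrow> 'v \<Rightarrow> 'e set" where
  "incident_edges G v = {e \<in> edges G. v \<in> ends G e}"

definition degree :: "('v, 'e) pre_multigraph \<Rightarrow> 'v \<Rightarrow> nat" where
  "degree G v = card (incident_edges G v)"

(* The inserted 0 only matters for the graph without vertices. *)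
definition max_degree :: "('v, 'e) pre_multigraph \<Rightarrow> nat" where
  "max_degree G = Max (insert 0 (degree G ` verts G))"

definition bipartite :: "('v, 'e) pre_multigraph \<Rightarrow> bool" where
  "bipartite G \<longleftrightarrow> (\<exists>X Y. X \<union> Y = verts G \<and> X \<inter> Y = {} \<and>
     (\<forall>e\<in>edges G. \<exists>x\<in>X. \<exists>y\<in>Y. ends G e = {x, y}))"

definition adjacent_edges :: "('v, 'e) pre_multigraph \<Rightarrow> 'e \<Rightarrow> 'e \<Rightarrow> bool" where
  "adjacent_edges G e e' \<longleftrightarrow> e \<noteq> e' \<and> ends G e \<inter> ends G e' \<noteq> {}"

definition proper_edge_coloring ::
    "('v, 'e) pre_multigraph \<Rightarrow> nat \<Rightarrow> ('e \<Rightarrow> nat) \<Rightarrow> bool" where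
  "proper_edge_coloring G t \<alpha> \<longleftrightarrow> \<alpha> ` edges G \<subseteq> {1..t} \<and>
     (\<forall>e\<in>edges G. \<forall>e'\<in>edges G. adjacent_edges G e e' \<longrightarrow> \<alpha> e \<noteq> \<alpha> e')"

definition colors_at ::
    "('v, 'e) pre_multigraph \<Rightarrow> 'v \<Rightarrow> ('e \<Rightarrow> nat) \<Rightarrow> nat set" where
  "colors_at G v \<alpha> = \<alpha> ` incident_edges G v"

(* The empty set counts as consecutive (take b < a). For cyclic interval colorings
   this convention is immaterial: if one of S and {1..t} - S is empty, the other
   one is {1..t}. *)
definition consecutive :: "nat set \<Rightarrow> bool" where
  "consecutive S \<longleftrightarrow> (\<exists>a b. S = {a..b})"

definition cyclic_interval_coloring ::
    "('v, 'e) pre_multigraph \<Rightarrow> nat \<Rightarrow> ('e \<Rightarrow> nat) \<Rightarrow> bool" where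
  "cyclic_interval_coloring G t \<alpha> \<longleftrightarrow> proper_edge_coloring G t \<alpha> \<and>
     (\<forall>v\<in>verts G. consecutive (colors_at G v \<alpha>) \<or>
        consecutive ({1..t} - colors_at G v \<alpha>))"

end

theory Submission
  imports Defs
begin

text \<open>
  Group the colors into the pairs \<open>{2j + 1, 2j + 2}\<close> for \<open>j < r\<close>. It suffices to color the edges
  with \<open>r\<close> colors, each occurring at most twice at a vertex, such that both edges at a vertex of
  degree \<open>2\<close> have the same color and some color is missing at a vertex of degree \<open>2r - 2\<close>: the
  color classes are then bipartite of maximum degree \<open>2\<close>, so each of them can be colored with one
  pair. As in Petersen's 2-factor theorem, such a coloring comes from an orientation of \<open>G\<close> with
  out- and indegrees at most \<open>\<lceil>d(v)/2\<rceil>\<close>: split every vertex into an out-copy and an in-copy, join the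
  two copies by \<open>r - \<lceil>d(v)/2\<rceil>\<close> further edges, and color the resulting bipartite multigraph of
  maximum degree at most \<open>r\<close> properly by Koenig's theorem. The colors of
  the further edges at \<open>v\<close> are missing on the edges of \<open>G\<close> at \<open>v\<close>. The orientation is itself a consequence of
  Koenig's theorem for maximum degree \<open>2\<close>.
\<close>

section \<open>Koenig's edge coloring theorem\<close>

text \<open>A bipartite multigraph is encoded by its edge set and two end maps, one into each side.
  The sides stay separate even if both maps have the same target, so the out-copy and in-copy of a
  vertex need no tags.\<close>

definition proper_on :: "'e set \<Rightarrow> ('e \<Rightarrow> 'a) \<Rightarrow> ('e \<Rightarrow> 'b) \<Rightarrow> ('e \<Rightarrow> nat) \<Rightarrow> bool" where
  "proper_on E f g c \<longleftrightarrow>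
     (\<forall>e\<in>E. \<forall>e'\<in>E. e \<noteq> e' \<longrightarrow> f e = f e' \<or> g e = g e' \<longrightarrow> c e \<noteq> c e')"

lemma proper_onD:
  assumes "proper_on E f g c" "e \<in> E" "e' \<in> E" "f e = f e' \<or> g e = g e'" "c e = c e'"
  shows "e = e'"
  using assms unfolding proper_on_def by blast

text \<open>
  The walk from \<open>a\<close> reaches ends under \<open>g\<close> only along edges of color \<open>q\<close>, so it never reaches an
  end where \<open>q\<close> is missing. This replaces the usual parity argument.
\<close>

inductive_set kempe :: "'e set \<Rightarrow> ('e \<Rightarrow> 'a) \<Rightarrow> ('e \<Rightarrow> 'b) \<Rightarrow> ('e \<Rightarrow> nat) \<Rightarrow> 'a \<Rightarrow> nat \<Rightarrow> nat \<Rightarrow> 'e set"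
  for E f g c a p q where
  start: "e \<in> E \<Longrightarrow> f e = a \<Longrightarrow> c e = q \<Longrightarrow> e \<in> kempe E f g c a p q"
| via_g: "e \<in> kempe E f g c a p q \<Longrightarrow> c e = q \<Longrightarrow> e' \<in> E \<Longrightarrow> c e' = p \<Longrightarrow> g e' = g e \<Longrightarrow>
    e' \<in> kempe E f g c a p q"
| via_f: "e \<in> kempe E f g c a p q \<Longrightarrow> c e = p \<Longrightarrow> e' \<in> E \<Longrightarrow> c e' = q \<Longrightarrow> f e' = f e \<Longrightarrow>
    e' \<in> kempe E f g c a p q"

lemma kempe_in: "e \<in> kempe E f g c a p q \<Longrightarrow> e \<in> E \<and> (c e = p \<or> c e = q)"
  by (induction rule: kempe.induct) auto

text \<open>An edge of the chain was entered at one end, where by properness the only edge of the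
  other color is its predecessor; a neighbor at its other end is added by a rule. A starting edge
  has no neighbor of color \<open>p\<close> at \<open>a\<close>.\<close>

lemma kempe_closed:
  assumes pr: "proper_on E f g c" and pq: "p \<noteq> q"
    and a: "\<And>e. e \<in> E \<Longrightarrow> f e = a \<Longrightarrow> c e \<noteq> p"
    and e: "e \<in> kempe E f g c a p q" and e': "e' \<in> E" "c e' = p \<or> c e' = q"
    and adj: "f e = f e' \<or> g e = g e'"
  shows "e' \<in> kempe E f g c a p q"
proof (cases "c e = c e'")
  case True
  then show ?thesis using proper_onD[OF pr _ e'(1) adj] kempe_in[OF e] e by auto
next
  case False
  from e show ?thesis
  proof cases
    case start
    then show ?thesis using False e' adj a pq kempe.via_g[OF e] by metis
  next
    case (via_g e0)
    then have "e0 = e'" if "g e = g e'"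
      using that False e' kempe_in[OF via_g(1)] proper_onD[OF pr, of e0 e'] by metis
    then show ?thesis using via_g False e' adj kempe.via_f[OF e] by metis
  next
    case (via_f e0)
    then have "e0 = e'" if "f e = f e'"
      using that False e' kempe_in[OF via_f(1)] proper_onD[OF pr, of e0 e'] by metis
    then show ?thesis using via_f False e' adj kempe.via_g[OF e] by metis
  qed
qed

lemma free_color:
  assumes "finite F" "card F < k"
  obtains p where "p < k" "p \<notin> c ` F"
proof -
  have "\<not> {..<k} \<subseteq> c ` F"
    using assms card_mono[of "c ` F" "{..<k}"] card_image_le[of F c] by auto
  then show thesis using that by blast
qed

text \<open>Swapping \<open>p\<close> and \<open>q\<close> on the chain from \<open>a\<close> frees
  \<open>q\<close> at \<open>a\<close> and keeps it free at \<open>b\<close>, so that a new edge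
  from \<open>a\<close> to \<open>b\<close> can take it.\<close>

lemma recolor_free:
  assumes pr: "proper_on E f g c" and ran: "c ` E \<subseteq> {..<k}"
    and p: "p < k" "\<And>e. e \<in> E \<Longrightarrow> f e = a \<Longrightarrow> c e \<noteq> p"
    and q: "q < k" "\<And>e. e \<in> E \<Longrightarrow> g e = b \<Longrightarrow> c e \<noteq> q"
  obtains c' where "proper_on E f g c'" "c' ` E \<subseteq> {..<k}"
    "\<And>e. e \<in> E \<Longrightarrow> f e = a \<or> g e = b \<Longrightarrow> c' e \<noteq> q"
proof (cases "p = q")
  case True
  then show thesis using that[OF pr ran] p q by blast
next
  case False
  define K where "K = kempe E f g c a p q"
  define c' where "c' e = (if e \<in> K then (if c e = p then q else p) else c e)" for e
  have closed: "e' \<in> K" if "e \<in> K" "e' \<in> E" "c e' = p \<or> c e' = q" "f e = f e' \<or> g e = g e'" for e e'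
    using kempe_closed[OF pr False p(2)] that unfolding K_def by metis
  have Kin: "e \<in> E \<and> (c e = p \<or> c e = q)" if "e \<in> K" for e
    using kempe_in that unfolding K_def by metis
  have "proper_on E f g c'"
    unfolding proper_on_def
  proof (intro ballI impI)
    fix e e' assume h: "e \<in> E" "e' \<in> E" "e \<noteq> e'" "f e = f e' \<or> g e = g e'"
    have ne: "c e \<noteq> c e'" using pr h unfolding proper_on_def by blast
    have h': "f e' = f e \<or> g e' = g e" using h(4) by auto
    show "c' e \<noteq> c' e'"
      using ne closed[OF _ h(2) _ h(4)] closed[OF _ h(1) _ h'] Kin[of e] Kin[of e']
      unfolding c'_def by (auto split: if_splits)
  qed
  moreover have "c' ` E \<subseteq> {..<k}" using ran p(1) q(1) by (auto simp: c'_def)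
  moreover have "c' e \<noteq> q" if "e \<in> E" "f e = a" for e
    using that p(2)[OF that] False kempe.start[of e E f a c q g p] unfolding c'_def K_def by auto
  \<comment> \<open>Only a chain edge of color \<open>p\<close> could turn into \<open>q\<close>
    here; it was entered at \<open>b\<close> from an edge of color \<open>q\<close>, but
    \<open>b\<close> has none.\<close>
  moreover have "c' e \<noteq> q" if "e \<in> E" "g e = b" for e
  proof
    assume "c' e = q"
    with q(2)[OF that] False have "e \<in> K" "c e = p" by (auto simp: c'_def split: if_splits)
    then have "e \<in> kempe E f g c a p q" unfolding K_def by simp
    then show False
    proof cases
      case start
      then show ?thesis using \<open>c e = p\<close> False by simp
    next
      case (via_g e0)
      then show ?thesis using q(2)[of e0] kempe_in[OF via_g(1)] that by auto
    next
      case (via_f e0)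
      then show ?thesis using \<open>c e = p\<close> False by simp
    qed
  qed
  ultimately show thesis using that by blast
qed

text \<open>Induction on the edges: each end of the new edge \<open>z\<close> has fewer than
  \<open>k\<close> old edges and so misses a color. After recoloring, both ends miss the same
  one.\<close>

theorem koenig:
  assumes "finite E"
    and "\<And>a. card {e\<in>E. f e = a} \<le> k" and "\<And>b. card {e\<in>E. g e = b} \<le> k"
  shows "\<exists>c. c ` E \<subseteq> {..<k} \<and> proper_on E f g c"
  using assms
proof (induction E rule: finite_induct)
  case empty
  show ?case by (auto simp: proper_on_def)
next
  case (insert z E)
  have f: "card {e\<in>E. f e = a} \<le> k" for a
    using card_mono[of "{e\<in>insert z E. f e = a}" "{e\<in>E. f e = a}"] insert.hyps(1) insert.prems(1)[of a]
    by force
  have g: "card {e\<in>E. g e = b} \<le> k" for b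
    using card_mono[of "{e\<in>insert z E. g e = b}" "{e\<in>E. g e = b}"] insert.hyps(1) insert.prems(2)[of b]
    by force
  obtain c where c: "c ` E \<subseteq> {..<k}" "proper_on E f g c" using insert.IH f g by blast
  have "{e\<in>insert z E. f e = f z} = insert z {e\<in>E. f e = f z}" by auto
  then have "card {e\<in>E. f e = f z} < k"
    using insert.prems(1)[of "f z"] insert.hyps by simp
  then obtain p where p: "p < k" "p \<notin> c ` {e\<in>E. f e = f z}"
    using free_color[of "{e\<in>E. f e = f z}" k c] insert.hyps(1) by auto
  have "{e\<in>insert z E. g e = g z} = insert z {e\<in>E. g e = g z}" by auto
  then have "card {e\<in>E. g e = g z} < k"
    using insert.prems(2)[of "g z"] insert.hyps by simp
  then obtain q where q: "q < k" "q \<notin> c ` {e\<in>E. g e = g z}"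
    using free_color[of "{e\<in>E. g e = g z}" k c] insert.hyps(1) by auto
  obtain c' where c': "proper_on E f g c'" "c' ` E \<subseteq> {..<k}"
    "\<And>e. e \<in> E \<Longrightarrow> f e = f z \<or> g e = g z \<Longrightarrow> c' e \<noteq> q"
    by (rule recolor_free[OF c(2,1) p(1) _ q(1), of "f z" "g z"]) (use p q in auto)
  have "proper_on (insert z E) f g (c'(z := q))"
    using c'(1) c'(3) insert.hyps(2) unfolding proper_on_def by (auto simp: eq_commute)
  moreover have "(c'(z := q)) ` insert z E \<subseteq> {..<k}" using c'(2) q(1) by auto
  ultimately show ?case by blast
qed

section \<open>Balanced splitting\<close>

text \<open>The edges at each vertex are numbered from 0 and grouped in twos; \<open>h e\<close> is
  the group of \<open>e\<close>. Splitting the vertices into their groups leaves degrees at most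
  2.\<close>

lemma ex_pairing:
  assumes "finite E"
  obtains h :: "'e \<Rightarrow> nat" where
    "\<And>a n. card {e\<in>E. f e = a \<and> h e = n} \<le> 2"
    "\<And>e. e \<in> E \<Longrightarrow> h e < (card {e'\<in>E. f e' = f e} + 1) div 2"
proof -
  have "\<exists>b. bij_betw b {e\<in>E. f e = a} {0..<card {e\<in>E. f e = a}}" for a
    by (rule ex_bij_betw_finite_nat) (simp add: assms)
  then obtain b where b: "\<And>a. bij_betw (b a) {e\<in>E. f e = a} {0..<card {e\<in>E. f e = a}}"
    by metis
  define h where "h e = b (f e) e div 2" for e
  have "card {e\<in>E. f e = a \<and> h e = n} \<le> 2" for a n
  proof -
    have "inj_on (b a) {e\<in>E. f e = a \<and> h e = n}"
      by (rule inj_on_subset[OF bij_betw_imp_inj_on[OF b[of a]]]) auto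
    moreover have "b a ` {e\<in>E. f e = a \<and> h e = n} \<subseteq> {2 * n, 2 * n + 1}"
      unfolding h_def by auto
    ultimately have "card {e\<in>E. f e = a \<and> h e = n} \<le> card {2 * n, 2 * n + 1}"
      by (intro card_inj_on_le) auto
    then show ?thesis by simp
  qed
  moreover have "h e < (card {e'\<in>E. f e' = f e} + 1) div 2" if "e \<in> E" for e
    using bij_betwE[OF b[of "f e"]] that unfolding h_def by fastforce
  ultimately show thesis using that by blast
qed

text \<open>With both sides split into groups, Koenig's theorem gives two colors. Each occurs at
  most once in a group, hence at most as often at a vertex as there are groups.\<close>

lemma balanced_splitting:
  assumes "finite E"
  obtains s :: "'e \<Rightarrow> nat" where "s ` E \<subseteq> {..<2}"
    "\<And>a i. card {e\<in>E. f e = a \<and> s e = i} \<le> (card {e\<in>E. f e = a} + 1) div 2"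
    "\<And>b i. card {e\<in>E. g e = b \<and> s e = i} \<le> (card {e\<in>E. g e = b} + 1) div 2"
proof -
  obtain h :: "'e \<Rightarrow> nat" where h: "\<And>a n. card {e\<in>E. f e = a \<and> h e = n} \<le> 2"
    "\<And>e. e \<in> E \<Longrightarrow> h e < (card {e'\<in>E. f e' = f e} + 1) div 2"
    by (rule ex_pairing[OF assms, where f = f]) (rule that; simp)
  obtain h' :: "'e \<Rightarrow> nat" where h': "\<And>a n. card {e\<in>E. g e = a \<and> h' e = n} \<le> 2"
    "\<And>e. e \<in> E \<Longrightarrow> h' e < (card {e'\<in>E. g e' = g e} + 1) div 2"
    by (rule ex_pairing[OF assms, where f = g]) (rule that; simp)
  obtain s where s: "s ` E \<subseteq> {..<2}" "proper_on E (\<lambda>e. (f e, h e)) (\<lambda>e. (g e, h' e)) s"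
    using koenig[OF assms, of "\<lambda>e. (f e, h e)" 2 "\<lambda>e. (g e, h' e)"] h(1) h'(1) by auto
  have "card {e\<in>E. f e = a \<and> s e = i} \<le> (card {e\<in>E. f e = a} + 1) div 2" for a i
  proof -
    have "inj_on h {e\<in>E. f e = a \<and> s e = i}"
      using proper_onD[OF s(2)] by (auto simp: inj_on_def)
    then show ?thesis
      using card_inj_on_le[of h _ "{..<(card {e\<in>E. f e = a} + 1) div 2}"] h(2) by fastforce
  qed
  moreover have "card {e\<in>E. g e = b \<and> s e = i} \<le> (card {e\<in>E. g e = b} + 1) div 2" for b i
  proof -
    have "inj_on h' {e\<in>E. g e = b \<and> s e = i}"
      using proper_onD[OF s(2)] by (auto simp: inj_on_def)
    then show ?thesis
      using card_inj_on_le[of h' _ "{..<(card {e\<in>E. g e = b} + 1) div 2}"] h'(2) by fastforce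
  qed
  ultimately show thesis using that s(1) by blast
qed

section \<open>Decomposition into subgraphs of maximum degree two\<close>

lemma decomposition:
  fixes x y :: "'e \<Rightarrow> 'v"
  assumes "finite E" "finite V" and disj: "x ` E \<inter> y ` E = {}"
    and deg: "\<And>v. card {e\<in>E. x e = v \<or> y e = v} \<le> 2 * r"
  shows "\<exists>c L. c ` E \<subseteq> {..<r} \<and>
    (\<forall>v j. card {e\<in>E. x e = v \<and> c e = j} \<le> 2) \<and>
    (\<forall>v j. card {e\<in>E. y e = v \<and> c e = j} \<le> 2) \<and>
    (\<forall>v\<in>V. L v \<subseteq> {..<r} \<and>
      card (L v) = r - (card {e\<in>E. x e = v \<or> y e = v} + 1) div 2 \<and>
      (\<forall>e\<in>E. x e = v \<or> y e = v \<longrightarrow> c e \<notin> L v))"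
proof -
  define d where "d v = card {e\<in>E. x e = v \<or> y e = v}" for v
  define m where "m v = r - (d v + 1) div 2" for v
  obtain s :: "'e \<Rightarrow> nat" where s: "s ` E \<subseteq> {..<2}"
    "\<And>a i. card {e\<in>E. x e = a \<and> s e = i} \<le> (card {e\<in>E. x e = a} + 1) div 2"
    "\<And>b i. card {e\<in>E. y e = b \<and> s e = i} \<le> (card {e\<in>E. y e = b} + 1) div 2"
    by (rule balanced_splitting[OF assms(1), where f = x and g = y]) (rule that; simp)
  have s01: "s e = 0 \<or> s e = 1" if "e \<in> E" for e using s(1) that by fastforce
  \<comment> \<open>\<open>s\<close> becomes an orientation, 0 meaning from \<open>x e\<close> to
    \<open>y e\<close>. As each vertex lies on one side only, its out-edges form one class of
    \<open>s\<close> and its in-edges the other.\<close>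
  define tail where "tail e = (if s e = 0 then x e else y e)" for e
  define head where "head e = (if s e = 0 then y e else x e)" for e
  have half: "card {e\<in>E. x e = v \<and> s e = i} \<le> (d v + 1) div 2 \<and>
      card {e\<in>E. y e = v \<and> s e = i} \<le> (d v + 1) div 2" for v i
  proof -
    have "card {e\<in>E. x e = v} \<le> d v" "card {e\<in>E. y e = v} \<le> d v"
      unfolding d_def by (auto intro!: card_mono simp: assms(1))
    then show ?thesis using s(2)[of v i] s(3)[of v i] by linarith
  qed
  have oriented: "card {e\<in>E. tail e = v} \<le> (d v + 1) div 2 \<and>
      card {e\<in>E. head e = v} \<le> (d v + 1) div 2" for v
  proof (cases "v \<in> x ` E")
    case True
    then have "v \<notin> y ` E" using disj by auto
    then have "{e\<in>E. tail e = v} = {e\<in>E. x e = v \<and> s e = 0}"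
      "{e\<in>E. head e = v} = {e\<in>E. x e = v \<and> s e = 1}"
      using s01 unfolding tail_def head_def by fastforce+
    then show ?thesis using half by simp
  next
    case False
    then have "{e\<in>E. tail e = v} = {e\<in>E. y e = v \<and> s e = 1}"
      "{e\<in>E. head e = v} = {e\<in>E. y e = v \<and> s e = 0}"
      using s01 unfolding tail_def head_def by fastforce+
    then show ?thesis using half by simp
  qed
  \<comment> \<open>The degree bound keeps the subtraction in \<open>m\<close> from being
    truncated.\<close>
  have dm: "(d v + 1) div 2 + m v = r" for v using deg[of v] unfolding m_def d_def by linarith

  \<comment> \<open>\<open>Inr (v, i)\<close> is the \<open>i\<close>-th further edge at
    \<open>v\<close>; \<open>fst\<close> sends it to \<open>v\<close> on both sides, so it joins the
    two copies.\<close>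
  define E' where "E' = E <+> (SIGMA v:V. {..<m v})"
  have fin: "finite E'" using assms(1,2) unfolding E'_def by simp
  have extended: "card {e\<in>E'. case_sum t fst e = v} \<le> r"
    if "card {e\<in>E. t e = v} \<le> (d v + 1) div 2" for t v
  proof -
    have "{e\<in>E'. case_sum t fst e = v} \<subseteq> Inl ` {e\<in>E. t e = v} \<union> (\<lambda>i. Inr (v, i)) ` {..<m v}"
      unfolding E'_def by (auto simp: Plus_def)
    then have "card {e\<in>E'. case_sum t fst e = v} \<le>
        card (Inl ` {e\<in>E. t e = v} \<union> (\<lambda>i. Inr (v, i) :: 'e + 'v \<times> nat) ` {..<m v})"
      by (rule card_mono[rotated]) (use assms(1) in auto)
    also have "\<dots> \<le> card (Inl ` {e\<in>E. t e = v} :: ('e + 'v \<times> nat) set) +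
        card ((\<lambda>i. Inr (v, i) :: 'e + 'v \<times> nat) ` {..<m v})"
      by (rule card_Un_le)
    also have "\<dots> \<le> card {e\<in>E. t e = v} + card {..<m v}"
      using assms(1) by (intro add_mono card_image_le) auto
    also have "\<dots> \<le> r" using that dm[of v] by simp
    finally show ?thesis .
  qed
  obtain C where C: "C ` E' \<subseteq> {..<r}" "proper_on E' (case_sum tail fst) (case_sum head fst) C"
    using koenig[OF fin, of "case_sum tail fst" r "case_sum head fst"] extended oriented by blast
  define c where "c e = C (Inl e)" for e
  define L where "L v = (\<lambda>i. C (Inr (v, i))) ` {..<m v}" for v
  have proper: "e = e'" if "e \<in> E" "e' \<in> E" "tail e = tail e' \<or> head e = head e'" "c e = c e'" for e e'
    using proper_onD[OF C(2), of "Inl e" "Inl e'"] that unfolding E'_def c_def by auto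
  have two: "card {e\<in>E. t e = v \<and> c e = j} \<le> 2" if t: "t = x \<or> t = y" for t v j
  proof -
    \<comment> \<open>Edges meeting at \<open>v\<close> with equal \<open>s\<close> share their tail
      or their head, so equal \<open>c\<close> makes them equal.\<close>
    have "inj_on s {e\<in>E. t e = v \<and> c e = j}"
      using proper t unfolding inj_on_def tail_def head_def by auto
    then have "card {e\<in>E. t e = v \<and> c e = j} \<le> card {..<2::nat}"
      using s(1) by (intro card_inj_on_le[of s]) auto
    then show ?thesis by simp
  qed
  show ?thesis
  proof (intro exI[of _ c] exI[of _ L] conjI allI ballI impI)
    show "c ` E \<subseteq> {..<r}" using C(1) unfolding c_def E'_def by auto
    show "card {e\<in>E. x e = v \<and> c e = j} \<le> 2" "card {e\<in>E. y e = v \<and> c e = j} \<le> 2" for v j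
      using two by auto
  next
    fix v assume v: "v \<in> V"
    show "L v \<subseteq> {..<r}" using C(1) v unfolding L_def E'_def by auto
    have "inj_on (\<lambda>i. C (Inr (v, i))) {..<m v}"
      using proper_onD[OF C(2), of "Inr (v, _)" "Inr (v, _)"] v unfolding E'_def
      by (auto simp: inj_on_def)
    then show "card (L v) = r - (card {e\<in>E. x e = v \<or> y e = v} + 1) div 2"
      unfolding L_def by (simp add: card_image m_def d_def)
    fix e assume e: "e \<in> E" "x e = v \<or> y e = v"
    show "c e \<notin> L v"
    proof
      assume "c e \<in> L v"
      then obtain i where "i < m v" "C (Inl e) = C (Inr (v, i))" unfolding L_def c_def by auto
      moreover have "tail e = v \<or> head e = v" using e(2) unfolding tail_def head_def by auto
      ultimately show False
        using proper_onD[OF C(2), of "Inl e" "Inr (v, i)"] e(1) v unfolding E'_def by auto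
    qed
  qed
qed

section \<open>The cyclic interval coloring\<close>

lemma consecutive_singleton: "card S = 1 \<Longrightarrow> consecutive S"
  by (metis atLeastAtMost_singleton card_1_singletonE consecutive_def)

lemma consecutive_Suc: "consecutive {n, Suc n}"
  unfolding consecutive_def by (intro exI[of _ n] exI[of _ "Suc n"]) auto

text \<open>\<open>(s - 1) div 2\<close> is the index of the pair containing \<open>s\<close>. For
  size 2, \<open>r - 1\<close> pairs are avoided and \<open>S\<close> is the remaining one; for size
  \<open>2 * r - 2\<close>, the complement is the single avoided pair. In the other cases
  \<open>S\<close> or its complement has at most one element.\<close>

lemma cyclic_interval_by_pairs:
  assumes S: "S \<subseteq> {1..2 * r}" and L: "L \<subseteq> {..<r}"
    and card_L: "card L = r - (card S + 1) div 2"
    and avoid: "\<And>s. s \<in> S \<Longrightarrow> (s - 1) div 2 \<notin> L"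
    and deg: "card S \<in> {1, 2, 2 * r - 2, 2 * r - 1, 2 * r}" and r: "r \<ge> 2"
  shows "consecutive S \<or> consecutive ({1..2 * r} - S)"
proof -
  have fin: "finite S" using S finite_subset by blast
  have compl: "card ({1..2 * r} - S) = 2 * r - card S"
    using S by (simp add: card_Diff_subset fin)
  consider "card S = 1" | "card S = 2" | "card S = 2 * r - 2" | "card S = 2 * r - 1" | "card S = 2 * r"
    using deg by auto
  then show ?thesis
  proof cases
    case 1
    then show ?thesis using consecutive_singleton by blast
  next
    case 2
    have "card ({..<r} - L) = 1"
      using L card_L 2 r by (simp add: card_Diff_subset finite_subset)
    then obtain j where j: "{..<r} - L = {j}" by (rule card_1_singletonE)
    have "S \<subseteq> {2 * j + 1, Suc (2 * j + 1)}"
    proof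
      fix s assume s: "s \<in> S"
      then have "s \<in> {1..2 * r}" using S by auto
      then have "(s - 1) div 2 \<in> {..<r} - L" using avoid[OF s] by auto
      then have "(s - 1) div 2 = j" using j by auto
      then show "s \<in> {2 * j + 1, Suc (2 * j + 1)}" using \<open>s \<in> {1..2 * r}\<close> by auto
    qed
    then have "S = {2 * j + 1, Suc (2 * j + 1)}" using 2 by (intro card_subset_eq) auto
    then show ?thesis using consecutive_Suc by simp
  next
    case 3
    then have "card L = 1" using card_L r by simp
    then obtain l where l: "L = {l}" by (rule card_1_singletonE)
    have "{2 * l + 1, Suc (2 * l + 1)} \<subseteq> {1..2 * r} - S"
      using avoid[of "2 * l + 1"] avoid[of "Suc (2 * l + 1)"] l L by auto
    then have "{2 * l + 1, Suc (2 * l + 1)} = {1..2 * r} - S"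
      using compl 3 r by (intro card_subset_eq) auto
    then show ?thesis using consecutive_Suc by metis
  next
    case 4
    then show ?thesis using consecutive_singleton compl r by simp
  next
    case 5
    then have "{1..2 * r} - S = {}" using compl by simp
    then show ?thesis unfolding consecutive_def by (metis atLeastatMost_empty_iff2 not_one_le_zero)
  qed
qed

theorem theorem1:
  fixes G :: "('v, 'e) pre_multigraph" and r :: nat
  assumes "r \<ge> 2"
    and "fin_multigraph G"
    and "bipartite G"
    and "max_degree G = 2 * r"
    and "\<And>v. v \<in> verts G \<Longrightarrow> degree G v \<in> {1, 2, 2 * r - 2, 2 * r - 1, 2 * r}"
  shows "\<exists>\<alpha>. cyclic_interval_coloring G (2 * r) \<alpha>"
proof -
  interpret fin_multigraph G by fact
  obtain X Y where XY: "X \<union> Y = verts G" "X \<inter> Y = {}"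
    "\<forall>e\<in>edges G. \<exists>a\<in>X. \<exists>b\<in>Y. ends G e = {a, b}"
    using assms(3) unfolding bipartite_def by blast
  then obtain x y where xy: "\<And>e. e \<in> edges G \<Longrightarrow> x e \<in> X \<and> y e \<in> Y \<and> ends G e = {x e, y e}"
    by metis
  have inc: "incident_edges G v = {e\<in>edges G. x e = v \<or> y e = v}" for v
    using xy unfolding incident_edges_def by auto
  \<comment> \<open>\<open>decomposition\<close> asks for the bound at every \<open>v\<close> of the
    type, hence the case of non-vertices.\<close>
  have deg: "card {e\<in>edges G. x e = v \<or> y e = v} \<le> 2 * r" for v
  proof (cases "v \<in> verts G")
    case True
    then show ?thesis using assms(5)[OF True] assms(1) unfolding degree_def inc by auto
  next
    case False
    then have "{e\<in>edges G. x e = v \<or> y e = v} = {}" using xy XY(1) by blast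
    then show ?thesis by (simp only: card.empty)
  qed
  have disj: "x ` edges G \<inter> y ` edges G = {}" using xy XY(2) by fastforce
  obtain c L where c: "c ` edges G \<subseteq> {..<r}"
    "\<forall>v j. card {e\<in>edges G. x e = v \<and> c e = j} \<le> 2"
    "\<forall>v j. card {e\<in>edges G. y e = v \<and> c e = j} \<le> 2"
    and L: "\<forall>v\<in>verts G. L v \<subseteq> {..<r} \<and>
      card (L v) = r - (card {e\<in>edges G. x e = v \<or> y e = v} + 1) div 2 \<and>
      (\<forall>e\<in>edges G. x e = v \<or> y e = v \<longrightarrow> c e \<notin> L v)"
    using decomposition[OF finite_edges finite_verts disj deg] by blast
  \<comment> \<open>Tagging the ends with \<open>c e\<close> forms the disjoint union of the color
    classes, so that all are 2-colored at once.\<close>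
  obtain b where b: "b ` edges G \<subseteq> {..<2}"
    "proper_on (edges G) (\<lambda>e. (x e, c e)) (\<lambda>e. (y e, c e)) b"
    using koenig[OF finite_edges, of "\<lambda>e. (x e, c e)" 2 "\<lambda>e. (y e, c e)"] c(2,3) by auto
  define \<alpha> where "\<alpha> e = 2 * c e + b e + 1" for e
  have b2: "b e < 2" if "e \<in> edges G" for e using b(1) that by auto
  have half: "(\<alpha> e - 1) div 2 = c e" if "e \<in> edges G" for e
    using b2[OF that] unfolding \<alpha>_def by simp
  have range: "\<alpha> e \<in> {1..2 * r}" if "e \<in> edges G" for e
  proof -
    have "c e < r" using c(1) that by auto
    then show ?thesis using b2[OF that] unfolding \<alpha>_def by auto
  qed
  have proper: "e = e'"
    if "e \<in> edges G" "e' \<in> edges G" "x e = x e' \<or> y e = y e'" "\<alpha> e = \<alpha> e'" for e e'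
  proof -
    have "c e = c e'" using half that by metis
    moreover from this have "b e = b e'" using that(4) unfolding \<alpha>_def by simp
    ultimately show ?thesis using proper_onD[OF b(2) that(1,2)] that(3) by auto
  qed
  \<comment> \<open>A common end lies in \<open>X\<close> or in \<open>Y\<close>, so it is the same
    end of both edges.\<close>
  have adj: "x e = x e' \<or> y e = y e'"
    if "e \<in> edges G" "e' \<in> edges G" "v \<in> ends G e" "v \<in> ends G e'" for e e' v
    using xy[OF that(1)] xy[OF that(2)] that(3,4) XY(2) by auto
  have "proper_edge_coloring G (2 * r) \<alpha>"
    unfolding proper_edge_coloring_def adjacent_edges_def using range proper adj by blast
  moreover have "consecutive (colors_at G v \<alpha>) \<or> consecutive ({1..2 * r} - colors_at G v \<alpha>)"
    if v: "v \<in> verts G" for v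
  proof (rule cyclic_interval_by_pairs[where L = "L v"])
    have "inj_on \<alpha> (incident_edges G v)"
      using proper adj unfolding inj_on_def incident_edges_def by blast
    then have card: "card (colors_at G v \<alpha>) = degree G v"
      unfolding colors_at_def degree_def by (rule card_image)
    then show "card (colors_at G v \<alpha>) \<in> {1, 2, 2 * r - 2, 2 * r - 1, 2 * r}"
      using assms(5)[OF v] by simp
    show "card (L v) = r - (card (colors_at G v \<alpha>) + 1) div 2"
      using L v card unfolding degree_def inc by simp
    show "colors_at G v \<alpha> \<subseteq> {1..2 * r}"
      using range unfolding colors_at_def incident_edges_def by auto
    show "L v \<subseteq> {..<r}" "r \<ge> 2" using L v assms(1) by auto
    show "(s - 1) div 2 \<notin> L v" if "s \<in> colors_at G v \<alpha>" for s
      using that half L v unfolding colors_at_def inc by auto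
  qed
  ultimately show ?thesis unfolding cyclic_interval_coloring_def by blast
qed

end
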